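(* Let $\psi:N^2\to\mathbb{R}^3$, $(v,w)\mapsto(v,w,f(v,w))$, be a positive definite improper affine sphere with affine normal $(0,0,1)$, and let $\gamma=(\gamma_1,\gamma_2):I\to\mathbb{R}^2$ be a curve. Define $\varphi:I\times N^2\to\mathbb{R}^4$ by $$\varphi(t,v,w)=(\gamma_1(t)v,\ \gamma_1(t)w,\ \gamma_1(t)f(v,w)+\gamma_2(t),\ \gamma_1(t)).$$ If $\gamma$ satisfies $\gamma_1^2\,|\gamma_1\gamma_2'-\gamma_1'\gamma_2|^5=-\operatorname{sign}(\gamma_1\gamma_1')\,(\gamma_1'\gamma_2''-\gamma_1''\gamma_2')\,(\gamma_1')^2\neq0$, then $\varphi$ defines a 3-dimensional indefinite proper affine hypersphere.
   Context: $D$ is the flat connection and $\det$ the volume form of $\mathbb{R}^{n+1}$. For a nondegenerate immersed hypersurface $\varphi:M^n\to\mathbb{R}^{n+1}$ the affine (Blaschke) normal $\xi$ is the transverse vector field, unique up to sign, such that (identifying tangent vectors with their images under $\varphi_*$) $D_XY=\nabla_XY+h(X,Y)\xi$, $D_X\xi=-SX$ with $SX$ tangential, and the volume form $\det(\varphi_*X_1,\dots,\varphi_*X_n,\xi)$ equals (up to orientation) the volume form $|\det h|^{1/2}$ of $h$. $h$ is the affine metric, $S$ the shape operator. $\varphi$ is an affine (hyper)sphere if $S=H\,\mathrm{Id}$ with $H$ constant; it is proper if $H\neq0$, improper if $H=0$, positive definite / indefinite if $h$ is. Curves are smooth, $I$ is an open interval, $N^2$ is an open set of parameters $(v,w)$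 in $\mathbb{R}^2$; the condition on $\gamma$ is required for all $t\in I$; primes denote $d/dt$. *)

theory Defs
  imports "HOL-Analysis.Analysis"
begin

(* C^k on an open set of a finite-dimensional space, by iterated directional derivatives. *)
primrec Ck_on :: "nat \<Rightarrow> 'a::euclidean_space set \<Rightarrow> ('a \<Rightarrow> 'b::real_normed_vector) \<Rightarrow> bool" where
  "Ck_on 0 U f \<longleftrightarrow> continuous_on U f"
| "Ck_on (Suc k) U f \<longleftrightarrow>
     (\<forall>x\<in>U. f differentiable (at x)) \<and> (\<forall>v. Ck_on k U (\<lambda>x. frechet_derivative f (at x) v))"

definition smooth_on :: "'a::euclidean_space set \<Rightarrow> ('a \<Rightarrow> 'b::real_normed_vector) \<Rightarrow> bool" where
  "smooth_on U f \<longleftrightarrow> (\<forall>k. Ck_on k U f)"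

(* A hypersurface is given by a parametrization phi on an open set U of R^n = real^'n with values
   in R^(n+1) = real^'m. Tangent vectors and tangent vector fields are written in the parameter
   domain; push phi x X is the image of X under the differential of phi at x. *)
abbreviation push :: "(real^'n \<Rightarrow> real^'m) \<Rightarrow> real^'n \<Rightarrow> real^'n \<Rightarrow> real^'m" where
  "push \<phi> x X \<equiv> frechet_derivative \<phi> (at x) X"

(* The flat connection, for a field V of vectors of the ambient space along the hypersurface. *)
abbreviation flat_deriv :: "real^'n \<Rightarrow> (real^'n \<Rightarrow> real^'m) \<Rightarrow> real^'n \<Rightarrow> real^'m" where
  "flat_deriv X V x \<equiv> frechet_derivative V (at x) X"

definition immersed_hypersurface :: "(real^'n) set \<Rightarrow> (real^'n \<Rightarrow> real^'m) \<Rightarrow> bool" where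
  "immersed_hypersurface U \<phi> \<longleftrightarrow>
     CARD('m) = CARD('n) + 1 \<and> open U \<and> smooth_on U \<phi> \<and> (\<forall>x\<in>U. inj (push \<phi> x))"

definition transverse_field ::
  "(real^'n) set \<Rightarrow> (real^'n \<Rightarrow> real^'m) \<Rightarrow> (real^'n \<Rightarrow> real^'m) \<Rightarrow> bool" where
  "transverse_field U \<phi> \<xi> \<longleftrightarrow> smooth_on U \<xi> \<and> (\<forall>x\<in>U. \<xi> x \<notin> range (push \<phi> x))"

(* D_X Y = nabla_X Y + h(X,Y) xi for all tangent vectors X and tangent vector fields Y;
   Z is the value of nabla_X Y at x. For a transverse xi this determines h on U. *)
definition gauss_formula ::
  "(real^'n) set \<Rightarrow> (real^'n \<Rightarrow> real^'m) \<Rightarrow> (real^'n \<Rightarrow> real^'m)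
    \<Rightarrow> (real^'n \<Rightarrow> real^'n \<Rightarrow> real^'n \<Rightarrow> real) \<Rightarrow> bool" where
  "gauss_formula U \<phi> \<xi> h \<longleftrightarrow>
     (\<forall>Y. smooth_on U Y \<longrightarrow> (\<forall>x\<in>U. \<forall>X. \<exists>Z.
        flat_deriv X (\<lambda>y. push \<phi> y (Y y)) x = push \<phi> x Z + h x X (Y x) *\<^sub>R \<xi> x))"

definition weingarten_formula ::
  "(real^'n) set \<Rightarrow> (real^'n \<Rightarrow> real^'m) \<Rightarrow> (real^'n \<Rightarrow> real^'m)
    \<Rightarrow> (real^'n \<Rightarrow> real^'n \<Rightarrow> real^'n) \<Rightarrow> bool" where
  "weingarten_formula U \<phi> \<xi> S \<longleftrightarrow> (\<forall>x\<in>U. \<forall>X. flat_deriv X \<xi> x = - push \<phi> x (S x X))"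

definition nondegenerate_on ::
  "(real^'n) set \<Rightarrow> (real^'n \<Rightarrow> real^'n \<Rightarrow> real^'n \<Rightarrow> real) \<Rightarrow> bool" where
  "nondegenerate_on U h \<longleftrightarrow> (\<forall>x\<in>U. \<forall>X. (\<forall>Y. h x X Y = 0) \<longrightarrow> X = 0)"

(* |det(X_1,...,X_n,xi)| = |det h(X_k,X_l)|^(1/2) for all X_1,...,X_n. The bijection e says which
   row of the determinant holds which vector (None standing for xi); it affects only the sign. *)
definition volume_condition ::
  "(real^'n) set \<Rightarrow> (real^'n \<Rightarrow> real^'m) \<Rightarrow> (real^'n \<Rightarrow> real^'m)
    \<Rightarrow> (real^'n \<Rightarrow> real^'n \<Rightarrow> real^'n \<Rightarrow> real) \<Rightarrow> bool" where
  "volume_condition U \<phi> \<xi> h \<longleftrightarrow>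
     (\<forall>x\<in>U. \<forall>(e :: 'm \<Rightarrow> 'n option) (X :: 'n \<Rightarrow> real^'n). bij e \<longrightarrow>
        \<bar>det (\<chi> i. case e i of None \<Rightarrow> \<xi> x | Some k \<Rightarrow> push \<phi> x (X k))\<bar>
        = sqrt \<bar>det (\<chi> k l. h x (X k) (X l))\<bar>)"

(* xi is an affine (Blaschke) normal of the nondegenerate immersed hypersurface phi,
   with affine metric h and shape operator S. *)
definition blaschke_structure ::
  "(real^'n) set \<Rightarrow> (real^'n \<Rightarrow> real^'m) \<Rightarrow> (real^'n \<Rightarrow> real^'m)
    \<Rightarrow> (real^'n \<Rightarrow> real^'n \<Rightarrow> real^'n \<Rightarrow> real) \<Rightarrow> (real^'n \<Rightarrow> real^'n \<Rightarrow> real^'n) \<Rightarrow> bool" where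
  "blaschke_structure U \<phi> \<xi> h S \<longleftrightarrow>
     immersed_hypersurface U \<phi> \<and> transverse_field U \<phi> \<xi> \<and>
     gauss_formula U \<phi> \<xi> h \<and> weingarten_formula U \<phi> \<xi> S \<and>
     nondegenerate_on U h \<and> volume_condition U \<phi> \<xi> h"

definition affine_sphere ::
  "(real^'n) set \<Rightarrow> (real^'n \<Rightarrow> real^'m) \<Rightarrow> (real^'n \<Rightarrow> real^'m)
    \<Rightarrow> (real^'n \<Rightarrow> real^'n \<Rightarrow> real^'n \<Rightarrow> real) \<Rightarrow> real \<Rightarrow> bool" where
  "affine_sphere U \<phi> \<xi> h H \<longleftrightarrow>
     (\<exists>S. blaschke_structure U \<phi> \<xi> h S \<and> (\<forall>x\<in>U. \<forall>X. S x X = H *\<^sub>R X))"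

definition positive_definite_on ::
  "(real^'n) set \<Rightarrow> (real^'n \<Rightarrow> real^'n \<Rightarrow> real^'n \<Rightarrow> real) \<Rightarrow> bool" where
  "positive_definite_on U h \<longleftrightarrow> (\<forall>x\<in>U. \<forall>X. X \<noteq> 0 \<longrightarrow> h x X X > 0)"

definition indefinite_on ::
  "(real^'n) set \<Rightarrow> (real^'n \<Rightarrow> real^'n \<Rightarrow> real^'n \<Rightarrow> real) \<Rightarrow> bool" where
  "indefinite_on U h \<longleftrightarrow> (\<forall>x\<in>U. (\<exists>X. h x X X > 0) \<and> (\<exists>Y. h x Y Y < 0))"

(* Since -xi is an affine normal with metric -h whenever xi is one with metric h, definiteness
   refers to the given normal xi. *)
definition pos_def_improper_affine_sphere ::
  "(real^'n) set \<Rightarrow> (real^'n \<Rightarrow> real^'m) \<Rightarrow> (real^'n \<Rightarrow> real^'m) \<Rightarrow> bool" where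
  "pos_def_improper_affine_sphere U \<phi> \<xi> \<longleftrightarrow>
     (\<exists>h. affine_sphere U \<phi> \<xi> h 0 \<and> positive_definite_on U h)"

definition indefinite_proper_affine_sphere :: "(real^'n) set \<Rightarrow> (real^'n \<Rightarrow> real^'m) \<Rightarrow> bool" where
  "indefinite_proper_affine_sphere U \<phi> \<longleftrightarrow>
     (\<exists>\<xi> h H. H \<noteq> 0 \<and> affine_sphere U \<phi> \<xi> h H \<and> indefinite_on U h)"

end

theory Submission
  imports Defs
begin

text \<open>
  The affine normal is the position vector $\xi = \varphi$ itself, so that $S = -\mathrm{Id}$ and
  $H = -1$. With $D = \gamma_1\gamma_2' - \gamma_1'\gamma_2$ and
  $E = \gamma_1'\gamma_2'' - \gamma_1''\gamma_2'$, decomposing the second derivatives of $\varphi$ along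
  $\varphi_t, \varphi_v, \varphi_w, \varphi$ gives $h_{tt} = -E/D$, $h_{tv} = h_{tw} = 0$ and
  $h_{ij} = -\gamma_1\gamma_1' f_{ij}/D$ for $i, j \in \{v, w\}$, while
  $\det(\varphi_t,\varphi_v,\varphi_w,\varphi) = \gamma_1^2 D$. The assumption on $\psi$ says that
  the Hessian of $f$ is positive definite with determinant $1$. Hence the volume condition
  $\gamma_1^4 D^2 = |\det h|$ is the absolute value of the equation for $\gamma$, and the sign in that
  equation, $\gamma_1\gamma_1' E < 0$, makes $h$ indefinite.
\<close>

subsection \<open>Calculus of smooth functions\<close>

text \<open>At a point of an open set the derivative depends only on values inside the set, so the
  induction may replace \<open>f\<close> by \<open>g\<close> in every directional
  derivative.\<close>

lemma Ck_on_cong: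
  assumes "open U" "\<And>x. x \<in> U \<Longrightarrow> f x = g x" "Ck_on k U f"
  shows "Ck_on k U g"
  using assms(2,3)
proof (induction k arbitrary: f g)
  case 0
  then show ?case
    using continuous_on_cong by (metis Ck_on.simps(1))
next
  case (Suc k)
  have diff: "f differentiable (at x)" if "x \<in> U" for x
    using Suc.prems that by simp
  have "g differentiable (at x)" if "x \<in> U" for x
    using has_derivative_transform_within_open[OF _ \<open>open U\<close> that, of f _ UNIV g] Suc.prems(1) diff[OF that]
    by (auto simp: differentiable_def)
  moreover have "Ck_on k U (\<lambda>x. frechet_derivative g (at x) v)" for v
  proof (rule Suc.IH)
    show "Ck_on k U (\<lambda>x. frechet_derivative f (at x) v)"
      using Suc.prems by simp
    show "frechet_derivative f (at x) v = frechet_derivative g (at x) v" if "x \<in> U" for x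
      using frechet_derivative_transform_within_open[OF diff[OF that] \<open>open U\<close> that Suc.prems(1)]
      by simp
  qed
  ultimately show ?case by simp
qed

text \<open>\<open>frechet_derivative\<close> is defined by choice and is awkward to compute with.
  Any explicit derivative \<open>f'\<close> coincides with it on \<open>U\<close>, so regularity can
  be checked on \<open>f'\<close> instead.\<close>

lemma Ck_on_SucI:
  assumes "open U" "\<And>x. x \<in> U \<Longrightarrow> (f has_derivative f' x) (at x)"
    and "\<And>v. Ck_on k U (\<lambda>x. f' x v)"
  shows "Ck_on (Suc k) U f"
proof -
  have "Ck_on k U (\<lambda>x. frechet_derivative f (at x) v)" for v
    using frechet_derivative_at[OF assms(2)]
    by (intro Ck_on_cong[OF \<open>open U\<close> _ assms(3)]) simp
  then show ?thesis
    using assms(2) by (auto intro: differentiableI)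
qed

lemma Ck_on_has_derivative:
  "Ck_on (Suc k) U f \<Longrightarrow> x \<in> U \<Longrightarrow> (f has_derivative frechet_derivative f (at x)) (at x)"
  by (simp add: frechet_derivative_works[symmetric])

lemma Ck_on_Suc_imp: "Ck_on (Suc k) U f \<Longrightarrow> Ck_on k U f"
proof (induction k arbitrary: f)
  case 0
  then show ?case
    by (simp add: continuous_at_imp_continuous_on differentiable_imp_continuous_within)
next
  case (Suc k)
  then show ?case by (metis Ck_on.simps(2))
qed

lemma Ck_on_const: "Ck_on k U (\<lambda>_. c)"
  by (induction k arbitrary: c) simp_all

lemma Ck_on_bounded_linear:
  assumes "open U" "bounded_linear L" "Ck_on k U f"
  shows "Ck_on k U (\<lambda>x. L (f x))"
  using assms(3)
proof (induction k arbitrary: f)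
  case 0
  then show ?case
    by (simp add: bounded_linear.continuous_on[OF assms(2)])
next
  case (Suc k)
  show ?case
    by (rule Ck_on_SucI[OF \<open>open U\<close> bounded_linear.has_derivative[OF assms(2) Ck_on_has_derivative[OF Suc.prems]]])
      (use Suc in auto)
qed

lemma Ck_on_add:
  assumes "open U" "Ck_on k U f" "Ck_on k U g"
  shows "Ck_on k U (\<lambda>x. f x + g x)"
  using assms(2,3)
proof (induction k arbitrary: f g)
  case 0
  then show ?case by (simp add: continuous_on_add)
next
  case (Suc k)
  show ?case
    by (rule Ck_on_SucI[OF \<open>open U\<close> has_derivative_add[OF Ck_on_has_derivative[OF Suc.prems(1)]
            Ck_on_has_derivative[OF Suc.prems(2)]]])
      (use Suc in auto)
qed

text \<open>By the Leibniz rule each directional derivative is a sum of two terms of the same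
  bilinear shape. One factor in each is undifferentiated and is lowered to class C^k by
  \<open>Ck_on_Suc_imp\<close>.\<close>

lemma Ck_on_bounded_bilinear:
  assumes "open U" "bounded_bilinear B" "Ck_on k U f" "Ck_on k U g"
  shows "Ck_on k U (\<lambda>x. B (f x) (g x))"
  using assms(3,4)
proof (induction k arbitrary: f g)
  case 0
  then show ?case by (simp add: bounded_bilinear.continuous_on[OF assms(2)])
next
  case (Suc k)
  show ?case
    by (rule Ck_on_SucI[OF \<open>open U\<close> bounded_bilinear.FDERIV[OF assms(2)
            Ck_on_has_derivative[OF Suc.prems(1)] Ck_on_has_derivative[OF Suc.prems(2)]]],
        assumption, assumption, rule Ck_on_add[OF \<open>open U\<close>])
      (use Suc Suc.prems[THEN Ck_on_Suc_imp] in auto)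
qed

text \<open>Since \<open>L\<close> is linear, the derivative of the composite in direction
  \<open>v\<close> is the derivative of \<open>g\<close> in the fixed direction \<open>L v\<close>,
  composed with \<open>L\<close> again. Hence the induction closes without a product rule.\<close>

lemma Ck_on_compose_linear:
  assumes "open V" "bounded_linear L" "Ck_on k V g"
  shows "Ck_on k (L -` V) (\<lambda>x. g (L x))"
  using assms(3)
proof (induction k arbitrary: g)
  case 0
  then show ?case
    by (auto intro!: continuous_on_compose2[of V g] linear_continuous_on[OF assms(2)])
next
  case (Suc k)
  have "open (L -` V)"
    using assms(1,2) continuous_open_vimage linear_continuous_at by blast
  moreover have "((\<lambda>x. g (L x)) has_derivative (\<lambda>v. frechet_derivative g (at (L x)) (L v))) (at x)"
    if "x \<in> L -` V" for x
    using has_derivative_compose[OF bounded_linear_imp_has_derivative[OF assms(2)]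
        Ck_on_has_derivative[OF Suc.prems]] that by auto
  ultimately show ?case
    by (rule Ck_on_SucI) (use Suc in auto)
qed

section \<open>Closure properties of smooth functions\<close>

lemma smooth_on_const: "smooth_on U (\<lambda>_. c)"
  by (simp add: smooth_on_def Ck_on_const)

lemma smooth_on_id:
  assumes "open U"
  shows "smooth_on U (\<lambda>x. x)"
proof -
  have "Ck_on k U (\<lambda>x. x)" for k
    by (cases k) (use Ck_on_SucI[OF assms has_derivative_ident Ck_on_const] in auto)
  then show ?thesis
    by (simp add: smooth_on_def)
qed

lemma smooth_on_bounded_linear:
  "open U \<Longrightarrow> bounded_linear L \<Longrightarrow> smooth_on U f \<Longrightarrow> smooth_on U (\<lambda>x. L (f x))"
  by (simp add: smooth_on_def Ck_on_bounded_linear)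

lemma smooth_on_add:
  "open U \<Longrightarrow> smooth_on U f \<Longrightarrow> smooth_on U g \<Longrightarrow> smooth_on U (\<lambda>x. f x + g x)"
  by (simp add: smooth_on_def Ck_on_add)

lemma smooth_on_mult:
  fixes f g :: "_ \<Rightarrow> 'a::real_normed_algebra"
  shows "open U \<Longrightarrow> smooth_on U f \<Longrightarrow> smooth_on U g \<Longrightarrow> smooth_on U (\<lambda>x. f x * g x)"
  by (simp add: smooth_on_def Ck_on_bounded_bilinear[OF _ bounded_bilinear_mult])

lemma smooth_on_compose_linear:
  "open V \<Longrightarrow> bounded_linear L \<Longrightarrow> smooth_on V g \<Longrightarrow> smooth_on (L -` V) (\<lambda>x. g (L x))"
  by (simp add: smooth_on_def Ck_on_compose_linear)

lemma smooth_on_subset: "smooth_on V f \<Longrightarrow> U \<subseteq> V \<Longrightarrow> smooth_on U f"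
proof -
  have "Ck_on k V f \<Longrightarrow> U \<subseteq> V \<Longrightarrow> Ck_on k U f" for k
  proof (induction k arbitrary: f)
    case 0
    then show ?case using continuous_on_subset by auto
  next
    case (Suc k)
    then show ?case by (meson Ck_on.simps(2) in_mono)
  qed
  then show "smooth_on V f \<Longrightarrow> U \<subseteq> V \<Longrightarrow> smooth_on U f"
    by (simp add: smooth_on_def)
qed

lemma smooth_on_has_derivative:
  "smooth_on U f \<Longrightarrow> x \<in> U \<Longrightarrow> (f has_derivative frechet_derivative f (at x)) (at x)"
  using Ck_on_has_derivative smooth_on_def by blast

lemma smooth_on_frechet_derivative:
  "smooth_on U f \<Longrightarrow> smooth_on U (\<lambda>x. frechet_derivative f (at x) v)"
  by (metis Ck_on.simps(2) smooth_on_def)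

lemma smooth_on_has_real_derivative:
  fixes f :: "real \<Rightarrow> real"
  assumes "smooth_on U f" "x \<in> U"
  shows "(f has_real_derivative deriv f x) (at x)"
  using smooth_on_has_derivative[OF assms] DERIV_deriv_iff_real_differentiable
  by (auto simp: differentiable_def)

lemma smooth_on_deriv:
  fixes f :: "real \<Rightarrow> real"
  assumes "open U" "smooth_on U f"
  shows "smooth_on U (deriv f)"
proof -
  have "frechet_derivative f (at x) 1 = deriv f x" if "x \<in> U" for x
    using frechet_derivative_at[OF smooth_on_has_real_derivative[OF assms(2) that, unfolded has_field_derivative_def]]
    by (metis mult.right_neutral)
  then show ?thesis
    using smooth_on_frechet_derivative[OF assms(2), of 1]
      Ck_on_cong[OF \<open>open U\<close>, of "\<lambda>x. frechet_derivative f (at x) 1" "deriv f"]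
    by (simp add: smooth_on_def)
qed

section \<open>Vector-valued functions, coordinate by coordinate\<close>

lemma vec_basis_expansion:
  fixes x :: "real^'n"
  shows "x = (\<Sum>i\<in>UNIV. x $ i *\<^sub>R axis i 1)"
  by (simp only: basis_expansion scalar_mult_eq_scaleR[symmetric])

lemma smooth_on_vec_componentwise:
  fixes f :: "_ \<Rightarrow> real^'n"
  assumes "open U" "\<And>i. smooth_on U (\<lambda>x. f x $ i)"
  shows "smooth_on U f"
proof -
  have "smooth_on U (\<lambda>x. \<Sum>i\<in>J. f x $ i *\<^sub>R axis i (1::real))" if "finite J" for J :: "'n set"
    using that
    by induction (simp_all add: smooth_on_const smooth_on_add assms
        smooth_on_bounded_linear[OF _ bounded_linear_scaleR_left])
  then have "smooth_on U (\<lambda>x. \<Sum>i\<in>UNIV. f x $ i *\<^sub>R axis i (1::real))"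
    by simp
  then show ?thesis
    by (simp only: vec_basis_expansion[symmetric])
qed

lemma has_derivative_vec_componentwise:
  fixes f :: "'a::real_normed_vector \<Rightarrow> real^'n"
  assumes "\<And>i. ((\<lambda>x. f x $ i) has_derivative (\<lambda>v. f' v $ i)) F"
  shows "(f has_derivative f') F"
proof -
  have "((\<lambda>x. \<Sum>i\<in>UNIV. f x $ i *\<^sub>R axis i (1::real)) has_derivative
      (\<lambda>v. \<Sum>i\<in>UNIV. f' v $ i *\<^sub>R axis i (1::real))) F"
    by (intro has_derivative_sum has_derivative_scaleR_left assms)
  then show ?thesis
    by (simp only: vec_basis_expansion[symmetric])
qed

subsection \<open>Four-dimensional vectors and determinants\<close>

lemma vector_4 [simp]:
  "(vector [x,y,z,w] :: 'a::zero^4) $ 1 = x"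
  "(vector [x,y,z,w] :: 'a::zero^4) $ 2 = y"
  "(vector [x,y,z,w] :: 'a::zero^4) $ 3 = z"
  "(vector [x,y,z,w] :: 'a::zero^4) $ 4 = w"
  unfolding vector_def by simp_all

text \<open>The sum over permutations is unrolled by inserting one index at a time. The right-hand
  side is the Laplace expansion along the first row.\<close>

lemma det_4:
  "det (A::'a::comm_ring_1^4^4) =
    A$1$1 * (A$2$2 * (A$3$3 * A$4$4 - A$3$4 * A$4$3) - A$2$3 * (A$3$2 * A$4$4 - A$3$4 * A$4$2)
           + A$2$4 * (A$3$2 * A$4$3 - A$3$3 * A$4$2))
  - A$1$2 * (A$2$1 * (A$3$3 * A$4$4 - A$3$4 * A$4$3) - A$2$3 * (A$3$1 * A$4$4 - A$3$4 * A$4$1)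
           + A$2$4 * (A$3$1 * A$4$3 - A$3$3 * A$4$1))
  + A$1$3 * (A$2$1 * (A$3$2 * A$4$4 - A$3$4 * A$4$2) - A$2$2 * (A$3$1 * A$4$4 - A$3$4 * A$4$1)
           + A$2$4 * (A$3$1 * A$4$2 - A$3$2 * A$4$1))
  - A$1$4 * (A$2$1 * (A$3$2 * A$4$3 - A$3$3 * A$4$2) - A$2$2 * (A$3$1 * A$4$3 - A$3$3 * A$4$1)
           + A$2$3 * (A$3$1 * A$4$2 - A$3$2 * A$4$1))"
proof -
  have f1234: "finite {2::4, 3, 4}" "1 \<notin> {2::4, 3, 4}"
    by auto
  have f234: "finite {3::4, 4}" "2 \<notin> {3::4, 4}"
    by auto
  have f34: "finite {4::4}" "3 \<notin> {4::4}"
    by auto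
  show ?thesis
    unfolding det_def UNIV_4
    unfolding sum_over_permutations_insert[OF f1234]
    unfolding sum_over_permutations_insert[OF f234]
    unfolding sum_over_permutations_insert[OF f34]
    unfolding permutes_sing
    by (simp add: sign_swap_id permutation_swap_id permutation_compose sign_compose sign_id swap_id_eq)
      (simp add: algebra_simps)
qed

text \<open>The two row orders differ by the permutation \<open>p = inv e' o e\<close>, which can
  change only the sign.\<close>

lemma abs_det_reindex_rows:
  fixes r :: "'k \<Rightarrow> real^'m"
  assumes "bij e" "bij e'"
  shows "\<bar>det (\<chi> i. r (e i))\<bar> = \<bar>det (\<chi> i. r (e' i))\<bar>"
proof -
  define p where "p = inv e' \<circ> e"
  have "bij p"
    unfolding p_def using assms by (simp add: bij_comp bij_imp_bij_inv)
  then have p: "p permutes UNIV"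
    by (simp add: permutes_altdef)
  have "e' (p i) = e i" for i
    using assms(2) by (simp add: p_def bij_is_surj surj_f_inv_f)
  then have "(\<chi> i. r (e i)) = (\<chi> i. (\<chi> j. r (e' j)) $ p i)"
    by simp
  then show ?thesis
    using det_permute_rows[OF p, of "\<chi> j. r (e' j)"] by (simp add: abs_mult sign_def)
qed

text \<open>Up to row order the matrix is a product \<open>A ** B\<close>, where \<open>A\<close> is
  the matrix of the \<open>X k\<close> bordered by a unit row and column, and \<open>B\<close> is
  the coordinate frame completed by \<open>w\<close>. This factors the left side of the volume
  condition.\<close>

lemma abs_det_bordered:
  fixes L :: "real^3 \<Rightarrow> real^4" and X :: "3 \<Rightarrow> real^3"
  assumes "linear L" "bij e"
  shows "\<bar>det (\<chi> i. case e i of None \<Rightarrow> w | Some k \<Rightarrow> L (X k))\<bar>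
    = \<bar>det (\<chi> k. X k)\<bar>
      * \<bar>det (vector [L (axis 1 1), L (axis 2 1), L (axis 3 1), w] :: real^4^4)\<bar>"
proof -
  define e' :: "4 \<Rightarrow> 3 option"
    where "e' i = (if i = 1 then Some 1 else if i = 2 then Some 2 else if i = 3 then Some 3 else None)" for i
  have e'_simps: "e' 1 = Some 1" "e' 2 = Some 2" "e' 3 = Some 3" "e' 4 = None"
    by (simp_all add: e'_def)
  have "inj e'"
    unfolding inj_def forall_4 by (simp add: e'_simps)
  moreover have "surj e'"
    unfolding surj_def by (metis e'_simps exhaust_3 not_None_eq)
  ultimately have "bij e'"
    by (rule bijI)
  define A :: "real^4^4" where "A = vector [vector [X 1 $ 1, X 1 $ 2, X 1 $ 3, 0],
      vector [X 2 $ 1, X 2 $ 2, X 2 $ 3, 0], vector [X 3 $ 1, X 3 $ 2, X 3 $ 3, 0], vector [0, 0, 0, 1]]"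
  define B :: "real^4^4" where "B = vector [L (axis 1 1), L (axis 2 1), L (axis 3 1), w]"
  have L: "L x $ j = x $ 1 * L (axis 1 1) $ j + x $ 2 * L (axis 2 1) $ j + x $ 3 * L (axis 3 1) $ j"
    for x :: "real^3" and j
    by (subst vec_basis_expansion[of x])
      (simp add: sum_3 linear_add[OF assms(1)] linear_cmul[OF assms(1)])
  have "(\<chi> i. case e' i of None \<Rightarrow> w | Some k \<Rightarrow> L (X k)) = A ** B"
    by (simp add: vec_eq_iff forall_4 e'_simps matrix_matrix_mult_def sum_4 A_def B_def L[of "X _"])
  moreover have "det A = det (\<chi> k. X k)"
    by (simp add: A_def det_4 det_3 algebra_simps)
  ultimately show ?thesis
    using abs_det_reindex_rows[OF assms(2) \<open>bij e'\<close>, of "\<lambda>k. case k of None \<Rightarrow> w | Some k \<Rightarrow> L (X k)"]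
    by (simp add: det_mul abs_mult B_def)
qed

text \<open>The Gram matrix is \<open>A ** G ** transpose A\<close>, with the \<open>X k\<close> as
  rows of \<open>A\<close>. After the square root the factor is \<open>|det A|\<close>, the same as
  in \<open>abs_det_bordered\<close>, so the volume condition need only be verified on the standard
  basis.\<close>

lemma det_gram:
  fixes h :: "real^'n \<Rightarrow> real^'n \<Rightarrow> real"
  assumes "bilinear h"
  shows "det (\<chi> k l. h (X k) (X l)) = (det (\<chi> k. X k))\<^sup>2 * det (\<chi> i j. h (axis i 1) (axis j 1))"
proof -
  define A :: "real^'n^'n" where "A = (\<chi> k. X k)"
  define G :: "real^'n^'n" where "G = (\<chi> i j. h (axis i 1) (axis j 1))"
  have expand: "h x y = (\<Sum>j\<in>UNIV. (\<Sum>i\<in>UNIV. x $ i * h (axis i 1) (axis j 1)) * y $ j)" for x y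
  proof -
    have "h x y = h (\<Sum>i\<in>UNIV. x $ i *\<^sub>R axis i 1) (\<Sum>j\<in>UNIV. y $ j *\<^sub>R axis j 1)"
      by (simp only: vec_basis_expansion[symmetric])
    also have "\<dots> = (\<Sum>i\<in>UNIV. \<Sum>j\<in>UNIV. x $ i * y $ j * h (axis i 1) (axis j 1))"
      by (simp add: bilinear_sum[OF assms] bilinear_lmul[OF assms] bilinear_rmul[OF assms]
          sum.cartesian_product mult_ac)
    also have "\<dots> = (\<Sum>j\<in>UNIV. (\<Sum>i\<in>UNIV. x $ i * h (axis i 1) (axis j 1)) * y $ j)"
      by (subst sum.swap) (simp add: sum_distrib_left mult_ac)
    finally show ?thesis .
  qed
  have "(\<chi> k l. h (X k) (X l)) = A ** G ** transpose A"
    by (simp add: expand[of "X _" "X _"] vec_eq_iff matrix_matrix_mult_def A_def G_def transpose_def)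
  then show ?thesis
    by (simp add: det_mul power2_eq_square A_def G_def)
qed

subsection \<open>Hessians of maps between Euclidean spaces\<close>

text \<open>This is the flat derivative along \<open>X\<close> of the image of the constant field
  \<open>Y\<close>. Vector values are allowed, so that the notion covers both the immersions and the
  graph function.\<close>

definition hessian :: "('a::euclidean_space \<Rightarrow> 'b::real_normed_vector) \<Rightarrow> 'a \<Rightarrow> 'a \<Rightarrow> 'a \<Rightarrow> 'b" where
  "hessian f x X Y = frechet_derivative (\<lambda>y. frechet_derivative f (at y) Y) (at x) X"

lemma linear_frechet_derivative_smooth:
  "smooth_on U f \<Longrightarrow> x \<in> U \<Longrightarrow> linear (frechet_derivative f (at x))"
  using has_derivative_linear smooth_on_has_derivative by blast

lemma frechet_derivative_cong_open:
  assumes "open U" "x \<in> U" "\<And>y. y \<in> U \<Longrightarrow> f y = g y" "(g has_derivative g') (at x)"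
  shows "frechet_derivative f (at x) = g'"
proof -
  have "(f has_derivative g') (at x)"
    using has_derivative_transform_within_open[OF assms(4,1,2)] assms(3) by simp
  then show ?thesis
    by (rule frechet_derivative_at[symmetric])
qed

lemma hessian_eqI:
  assumes "open U" "x \<in> U" "\<And>y. y \<in> U \<Longrightarrow> frechet_derivative f (at y) Y = g y"
    and "(g has_derivative g') (at x)"
  shows "hessian f x X Y = g' X"
  unfolding hessian_def by (subst frechet_derivative_cong_open[OF assms]) auto

text \<open>Expanding \<open>Y\<close> in the basis turns the pushed field into a sum of scalar
  functions times derivatives in fixed directions, to which the product rule applies. Constant
  \<open>Y\<close> then gives linearity of the Hessian, and smooth \<open>Y\<close> gives the Gauss
  formula.\<close>

lemma frechet_derivative_push_field:
  assumes "open U" "smooth_on U f" "x \<in> U" "(Y has_derivative Y') (at x)"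
  shows "frechet_derivative (\<lambda>y. frechet_derivative f (at y) (Y y)) (at x) X
    = (\<Sum>b\<in>Basis. (Y x \<bullet> b) *\<^sub>R hessian f x X b) + frechet_derivative f (at x) (Y' X)"
proof -
  have expand: "frechet_derivative f (at y) v = (\<Sum>b\<in>Basis. (v \<bullet> b) *\<^sub>R frechet_derivative f (at y) b)"
    if "y \<in> U" for y v
    using linear_frechet_derivative_smooth[OF assms(2) that]
    by (subst euclidean_representation[of v, symmetric])
      (simp only: linear_sum linear_cmul)
  have "((\<lambda>y. frechet_derivative f (at y) b) has_derivative (\<lambda>X. hessian f x X b)) (at x)" for b
    using smooth_on_has_derivative[OF smooth_on_frechet_derivative[OF assms(2)] assms(3)]
    by (simp add: hessian_def)
  then have "((\<lambda>y. \<Sum>b\<in>Basis. (Y y \<bullet> b) *\<^sub>R frechet_derivative f (at y) b) has_derivative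
      (\<lambda>X. \<Sum>b\<in>Basis. (Y x \<bullet> b) *\<^sub>R hessian f x X b + (Y' X \<bullet> b) *\<^sub>R frechet_derivative f (at x) b)) (at x)"
    by (intro has_derivative_sum has_derivative_scaleR has_derivative_inner_left assms(4))
  from frechet_derivative_cong_open[OF assms(1,3) expand this]
  show ?thesis
    by (simp add: sum.distrib expand[OF assms(3), symmetric])
qed

lemma hessian_expand_right:
  assumes "open U" "smooth_on U f" "x \<in> U"
  shows "hessian f x X Y = (\<Sum>b\<in>Basis. (Y \<bullet> b) *\<^sub>R hessian f x X b)"
  using frechet_derivative_push_field[OF assms has_derivative_const, of Y]
    linear_0[OF linear_frechet_derivative_smooth[OF assms(2,3)]]
  by (simp add: hessian_def)

text \<open>Linearity in \<open>X\<close> is that of a derivative. Linearity in \<open>Y\<close>,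
  which sits inside the differentiated function, comes from the basis expansion.\<close>

lemma bilinear_hessian:
  assumes "open U" "smooth_on U f" "x \<in> U"
  shows "bilinear (hessian f x)"
  unfolding bilinear_def
proof (intro conjI allI)
  have "linear (\<lambda>Y. \<Sum>b\<in>Basis. (Y \<bullet> b) *\<^sub>R hessian f x X b)" for X
    by (rule linearI) (simp_all add: inner_add_left scaleR_add_left sum.distrib scaleR_sum_right)
  then show "linear (hessian f x X)" for X
    by (simp only: hessian_expand_right[OF assms, symmetric])
  show "linear (\<lambda>X. hessian f x X Y)" for Y
    unfolding hessian_def
    using linear_frechet_derivative_smooth[OF smooth_on_frechet_derivative[OF assms(2)] assms(3)] .
qed

lemma flat_deriv_push:
  assumes "open U" "smooth_on U f" "x \<in> U" "smooth_on U Y"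
  shows "frechet_derivative (\<lambda>y. frechet_derivative f (at y) (Y y)) (at x) X
    = hessian f x X (Y x) + frechet_derivative f (at x) (frechet_derivative Y (at x) X)"
  by (simp only: frechet_derivative_push_field[OF assms(1-3) smooth_on_has_derivative[OF assms(4,3)]]
      hessian_expand_right[OF assms(1-3), symmetric])

text \<open>Constant fields give one direction. Conversely, a varying field \<open>Y\<close> only
  adds the image of its own derivative, which is tangential and is absorbed into
  \<open>Z\<close>.\<close>

lemma gauss_formula_iff_hessian:
  assumes "open U" "smooth_on U \<phi>"
  shows "gauss_formula U \<phi> \<xi> h \<longleftrightarrow>
    (\<forall>x\<in>U. \<forall>X Y. \<exists>Z. hessian \<phi> x X Y = push \<phi> x Z + h x X Y *\<^sub>R \<xi> x)" (is "_ \<longleftrightarrow> ?R")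
proof
  assume g: "gauss_formula U \<phi> \<xi> h"
  show ?R
  proof (intro ballI allI)
    fix x X Y assume x: "x \<in> U"
    show "\<exists>Z. hessian \<phi> x X Y = push \<phi> x Z + h x X Y *\<^sub>R \<xi> x"
      unfolding hessian_def
      using g[unfolded gauss_formula_def, rule_format, OF smooth_on_const x] .
  qed
next
  assume R: ?R
  show "gauss_formula U \<phi> \<xi> h"
    unfolding gauss_formula_def
  proof (intro allI impI ballI)
    fix Y :: "real^'a \<Rightarrow> real^'a" and x X
    assume Y: "smooth_on U Y" and x: "x \<in> U"
    obtain Z where Z: "hessian \<phi> x X (Y x) = push \<phi> x Z + h x X (Y x) *\<^sub>R \<xi> x"
      using R x by blast
    have "flat_deriv X (\<lambda>y. push \<phi> y (Y y)) x
        = push \<phi> x (Z + frechet_derivative Y (at x) X) + h x X (Y x) *\<^sub>R \<xi> x"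
      by (simp add: flat_deriv_push[OF assms x Y] Z
          linear_add[OF linear_frechet_derivative_smooth[OF assms(2) x]])
    then show "\<exists>Z. flat_deriv X (\<lambda>y. push \<phi> y (Y y)) x = push \<phi> x Z + h x X (Y x) *\<^sub>R \<xi> x"
      by blast
  qed
qed

subsection \<open>Graphs and cones over graphs\<close>

lemma has_derivative_nth: "((\<lambda>x :: real^'n. x $ i) has_derivative (\<lambda>v. v $ i)) F"
  by (rule bounded_linear_imp_has_derivative[OF bounded_linear_vec_nth])

text \<open>Second derivatives of a graph are vertical, hence multiples of the normal, so the affine
  metric is the Hessian of \<open>F\<close>. The coordinate frame together with the normal has
  determinant 1, which the volume condition carries over to the Hessian.\<close>

lemma improper_sphere_graph:
  fixes F :: "real^2 \<Rightarrow> real" and \<psi> :: "real^2 \<Rightarrow> real^3"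
  assumes \<psi>: "\<And>p. \<psi> p = vector [p$1, p$2, F p]"
    and sphere: "pos_def_improper_affine_sphere N \<psi> (\<lambda>_. vector [0, 0, 1])"
  shows "smooth_on N F"
    and "\<And>q X. q \<in> N \<Longrightarrow> X \<noteq> 0 \<Longrightarrow> 0 < hessian F q X X"
    and "\<And>q. q \<in> N \<Longrightarrow> \<bar>det (\<chi> i j. hessian F q (axis i 1) (axis j 1) :: real^2^2)\<bar> = 1"
proof -
  obtain h S where bl: "blaschke_structure N \<psi> (\<lambda>_. vector [0, 0, 1]) h S"
    and pos: "positive_definite_on N h"
    using sphere by (auto simp: pos_def_improper_affine_sphere_def affine_sphere_def)
  have N: "open N" and sm: "smooth_on N \<psi>"
    using bl by (auto simp: blaschke_structure_def immersed_hypersurface_def)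
  have "(\<lambda>p. \<psi> p $ 3) = F"
    by (simp add: \<psi>)
  then show F: "smooth_on N F"
    using smooth_on_bounded_linear[OF N bounded_linear_vec_nth sm, of 3] by simp
  have push: "push \<psi> q X = vector [X$1, X$2, frechet_derivative F (at q) X]" if "q \<in> N" for q X
  proof -
    have "(\<psi> has_derivative (\<lambda>X. vector [X$1, X$2, frechet_derivative F (at q) X])) (at q)"
      unfolding \<psi>
      by (rule has_derivative_vec_componentwise, rule forall_3[THEN iffD2, rule_format])
        (simp add: has_derivative_nth smooth_on_has_derivative[OF F that])
    then show ?thesis
      by (simp only: frechet_derivative_at[symmetric])
  qed
  have hess: "hessian \<psi> q X Y = vector [0, 0, hessian F q X Y]" if "q \<in> N" for q X Y
  proof (rule hessian_eqI[OF N that push])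
    show "((\<lambda>y. vector [Y$1, Y$2, frechet_derivative F (at y) Y] :: real^3) has_derivative
        (\<lambda>X. vector [0, 0, hessian F q X Y])) (at q)"
      by (rule has_derivative_vec_componentwise, rule forall_3[THEN iffD2, rule_format])
        (simp add: hessian_def smooth_on_has_derivative[OF smooth_on_frechet_derivative[OF F] that])
  qed
  have h: "h q X Y = hessian F q X Y" if "q \<in> N" for q X Y
  proof -
    have "gauss_formula N \<psi> (\<lambda>_. vector [0, 0, 1]) h"
      using bl by (simp add: blaschke_structure_def)
    from this[unfolded gauss_formula_iff_hessian[OF N sm], rule_format, OF that]
    obtain Z where "hessian \<psi> q X Y = push \<psi> q Z + h q X Y *\<^sub>R vector [0, 0, 1]"
      by blast
    \<comment> \<open>The first two coordinates of a tangent vector of the graph are those of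
      \<open>Z\<close>, so a vertical one has \<open>Z = 0\<close>.\<close>
    then have Z: "Z $ 1 = 0" "Z $ 2 = 0" "hessian F q X Y = frechet_derivative F (at q) Z + h q X Y"
      by (simp_all add: hess[OF that] push[OF that] vec_eq_iff forall_3)
    then have "Z = 0"
      by (simp add: vec_eq_iff forall_2)
    with Z(3) show ?thesis
      using linear_0[OF linear_frechet_derivative_smooth[OF F that]] by simp
  qed
  show "0 < hessian F q X X" if "q \<in> N" "X \<noteq> 0" for q X
    using pos that h by (simp add: positive_definite_on_def)
  show "\<bar>det (\<chi> i j. hessian F q (axis i 1) (axis j 1) :: real^2^2)\<bar> = 1" if "q \<in> N" for q
  proof -
    define e :: "3 \<Rightarrow> 2 option" where "e i = (if i = 1 then Some 1 else if i = 2 then Some 2 else None)" for i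
    have e_simps: "e 1 = Some 1" "e 2 = Some 2" "e 3 = None"
      by (simp_all add: e_def)
    have "inj e"
      unfolding inj_def forall_3 by (simp add: e_simps)
    moreover have "surj e"
      unfolding surj_def by (metis e_simps exhaust_2 not_None_eq)
    ultimately have "bij e"
      by (rule bijI)
    have vol: "volume_condition N \<psi> (\<lambda>_. vector [0, 0, 1]) h"
      using bl by (simp add: blaschke_structure_def)
    have "\<bar>det (\<chi> i. case e i of None \<Rightarrow> vector [0, 0, 1] | Some k \<Rightarrow> push \<psi> q (axis k 1))\<bar>
        = sqrt \<bar>det (\<chi> k l. h q (axis k 1) (axis l 1))\<bar>"
      using vol[unfolded volume_condition_def, rule_format, OF that \<open>bij e\<close>, of "\<lambda>k. axis k 1"] .
    moreover have "det (\<chi> i. case e i of None \<Rightarrow> vector [0, 0, 1]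
        | Some k \<Rightarrow> push \<psi> q (axis k 1)) = 1"
      by (simp add: det_3 e_simps push[OF that] axis_def)
    ultimately show ?thesis
      by (simp add: h[OF that])
  qed
qed

text \<open>The left side of the equation is nonnegative and nonzero, so the right side is positive:
  no factor vanishes, and \<open>E\<close> has the sign opposite to \<open>a * a'\<close>.\<close>

lemma curve_condition_signs:
  fixes a a' D E :: real
  assumes eq: "a\<^sup>2 * \<bar>D\<bar> ^ 5 = - sgn (a * a') * E * a'\<^sup>2" and nz: "a\<^sup>2 * \<bar>D\<bar> ^ 5 \<noteq> 0"
  shows "a \<noteq> 0" "D \<noteq> 0" "a' \<noteq> 0" "a * a' * E < 0" "a\<^sup>2 * \<bar>D\<bar> ^ 5 = \<bar>E\<bar> * a'\<^sup>2"
proof -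
  show "a \<noteq> 0" "D \<noteq> 0" "a' \<noteq> 0"
    using nz eq by auto
  then have pos: "0 < - sgn (a * a') * E * a'\<^sup>2"
    using eq[symmetric] by simp
  then have neg: "sgn (a * a') * E < 0"
    by (simp add: zero_less_mult_iff mult_less_0_iff)
  have "sgn x * E < 0 \<Longrightarrow> x * E < 0" for x :: real
    by (cases x "0 :: real" rule: linorder_cases) (auto simp: mult_less_0_iff)
  with neg show "a * a' * E < 0"
    by blast
  have "\<bar>sgn (a * a') * E\<bar> = \<bar>E\<bar>"
    using \<open>a \<noteq> 0\<close> \<open>a' \<noteq> 0\<close> by (simp add: abs_mult abs_sgn_eq)
  then show "a\<^sup>2 * \<bar>D\<bar> ^ 5 = \<bar>E\<bar> * a'\<^sup>2"
    using neg eq by simp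
qed

theorem theorem5:
  fixes I :: "real set" and N :: "(real^2) set"
    and f :: "real \<Rightarrow> real \<Rightarrow> real" and \<gamma>1 \<gamma>2 :: "real \<Rightarrow> real"
    and \<psi> :: "real^2 \<Rightarrow> real^3" and \<phi> :: "real^3 \<Rightarrow> real^4"
  assumes I: "open I" "is_interval I"
    and N: "open N"
    and \<psi>: "\<And>p. \<psi> p = vector [p$1, p$2, f (p$1) (p$2)]"
    and \<psi>_sphere: "pos_def_improper_affine_sphere N \<psi> (\<lambda>_. vector [0, 0, 1])"
    and \<gamma>_smooth: "smooth_on I (\<lambda>t. (\<gamma>1 t, \<gamma>2 t))"
    and \<phi>: "\<And>p. \<phi> p = vector [\<gamma>1 (p$1) * p$2, \<gamma>1 (p$1) * p$3,
                             \<gamma>1 (p$1) * f (p$2) (p$3) + \<gamma>2 (p$1), \<gamma>1 (p$1)]"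
    and \<gamma>_eq: "\<And>t. t \<in> I \<Longrightarrow>
          (\<gamma>1 t)\<^sup>2 * \<bar>\<gamma>1 t * deriv \<gamma>2 t - deriv \<gamma>1 t * \<gamma>2 t\<bar> ^ 5
          = - sgn (\<gamma>1 t * deriv \<gamma>1 t)
              * (deriv \<gamma>1 t * deriv (deriv \<gamma>2) t - deriv (deriv \<gamma>1) t * deriv \<gamma>2 t)
              * (deriv \<gamma>1 t)\<^sup>2"
    and \<gamma>_nz: "\<And>t. t \<in> I \<Longrightarrow>
          (\<gamma>1 t)\<^sup>2 * \<bar>\<gamma>1 t * deriv \<gamma>2 t - deriv \<gamma>1 t * \<gamma>2 t\<bar> ^ 5 \<noteq> 0"
  shows "indefinite_proper_affine_sphere {p. p$1 \<in> I \<and> vector [p$2, p$3] \<in> N} \<phi>"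
proof -
  define F :: "real^2 \<Rightarrow> real" where "F q = f (q$1) (q$2)" for q
  \<comment> \<open>Through \<open>L\<close> the graph function enters the cone only by composition
    with a linear map, so the linear chain rule suffices.\<close>
  define L :: "real^3 \<Rightarrow> real^2" where "L p = vector [p$2, p$3]" for p
  define U where "U = {p :: real^3. p$1 \<in> I \<and> vector [p$2, p$3] \<in> N}"
  have U_iff: "p \<in> U \<longleftrightarrow> p$1 \<in> I \<and> L p \<in> N" for p
    by (simp add: U_def L_def)
  have U: "U = (\<lambda>p. p$1) -` I \<inter> L -` N"
    by (auto simp: U_iff)
  have \<psi>F: "\<psi> p = vector [p$1, p$2, F p]" for p
    by (simp add: \<psi> F_def)
  have \<phi>F: "\<phi> p = vector [\<gamma>1 (p$1) * p$2, \<gamma>1 (p$1) * p$3, \<gamma>1 (p$1) * F (L p) + \<gamma>2 (p$1), \<gamma>1 (p$1)]" for p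
    by (simp add: \<phi> F_def L_def)
  have F_smooth: "smooth_on N F"
    and F_pos: "\<And>q X. q \<in> N \<Longrightarrow> X \<noteq> 0 \<Longrightarrow> 0 < hessian F q X X"
    and F_det: "\<And>q. q \<in> N \<Longrightarrow> \<bar>det (\<chi> i j. hessian F q (axis i 1) (axis j 1) :: real^2^2)\<bar> = 1"
    using improper_sphere_graph[OF \<psi>F \<psi>_sphere] by blast+
  have \<gamma>1: "smooth_on I \<gamma>1" and \<gamma>2: "smooth_on I \<gamma>2"
    using smooth_on_bounded_linear[OF I(1) bounded_linear_fst \<gamma>_smooth]
      smooth_on_bounded_linear[OF I(1) bounded_linear_snd \<gamma>_smooth] by simp_all

  have L_lin: "linear L"
    by (rule linearI) (simp_all add: L_def vec_eq_iff forall_2)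
  then have L: "bounded_linear L"
    by (simp add: linear_conv_bounded_linear)
  have F'_lin: "linear (frechet_derivative F (at q))" if "q \<in> N" for q
    by (rule linear_frechet_derivative_smooth[OF F_smooth that])
  have H_bilin: "bilinear (hessian F q)" if "q \<in> N" for q
    by (rule bilinear_hessian[OF N F_smooth that])
  have U_open: "open U"
    unfolding U
    by (intro open_Int continuous_open_vimage I(1) N linear_continuous_at L bounded_linear_vec_nth)

  \<comment> \<open>Smoothness and derivatives of the cone\<close>
  have smooth1: "smooth_on U (\<lambda>p. c (p$1))" if "smooth_on I c" for c :: "real \<Rightarrow> real"
    by (rule smooth_on_subset[OF smooth_on_compose_linear[OF I(1) bounded_linear_vec_nth that]])
      (simp add: U)
  have smooth2: "smooth_on U (\<lambda>p. F (L p))"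
    by (rule smooth_on_subset[OF smooth_on_compose_linear[OF N L F_smooth]]) (simp add: U)
  have smooth3: "smooth_on U (\<lambda>p. p$i)" for i
    by (rule smooth_on_bounded_linear[OF U_open bounded_linear_vec_nth smooth_on_id[OF U_open]])
  have \<phi>_smooth: "smooth_on U \<phi>"
    unfolding \<phi>F
    by (rule smooth_on_vec_componentwise[OF U_open], rule forall_4[THEN iffD2, rule_format])
      (simp add: smooth_on_add smooth_on_mult smooth1 smooth2 smooth3 U_open \<gamma>1 \<gamma>2)

  have deriv1: "((\<lambda>p. c (p$1)) has_derivative (\<lambda>X. deriv c (p$1) * X$1)) (at p)"
    if "smooth_on I c" "p \<in> U" for c :: "real \<Rightarrow> real" and p :: "real^3"
    using has_derivative_compose[OF has_derivative_nth[of 1 "at p"],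
        of c "(*) (deriv c (p$1))"] smooth_on_has_real_derivative[OF that(1), of "p$1"] that(2)
    by (simp add: has_field_derivative_def U_iff)
  have deriv2: "((\<lambda>p. F (L p)) has_derivative (\<lambda>X. frechet_derivative F (at (L p)) (L X))) (at p)"
    if "p \<in> U" for p
    using has_derivative_compose[OF bounded_linear_imp_has_derivative[OF L]
        smooth_on_has_derivative[OF F_smooth]] that by (simp add: U_iff)
  have deriv3: "((\<lambda>p. frechet_derivative F (at (L p)) Y) has_derivative
      (\<lambda>X. hessian F (L p) (L X) Y)) (at p)" if "p \<in> U" for p Y
    using has_derivative_compose[OF bounded_linear_imp_has_derivative[OF L]
        smooth_on_has_derivative[OF smooth_on_frechet_derivative[OF F_smooth]]] that
    by (simp add: U_iff hessian_def)
  \<comment> \<open>With \<open>has_derivative_eq_rhs\<close> the rules match any claimed derivative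
    and leave an algebraic identity to check.\<close>
  note derivs = deriv1[OF \<gamma>1, THEN has_derivative_eq_rhs] deriv1[OF \<gamma>2, THEN has_derivative_eq_rhs]
    deriv1[OF smooth_on_deriv[OF I(1) \<gamma>1], THEN has_derivative_eq_rhs]
    deriv1[OF smooth_on_deriv[OF I(1) \<gamma>2], THEN has_derivative_eq_rhs]
    deriv2[THEN has_derivative_eq_rhs] deriv3[THEN has_derivative_eq_rhs]
    has_derivative_nth[THEN has_derivative_eq_rhs]

  have push: "push \<phi> p X = vector
      [deriv \<gamma>1 (p$1) * X$1 * p$2 + \<gamma>1 (p$1) * X$2,
       deriv \<gamma>1 (p$1) * X$1 * p$3 + \<gamma>1 (p$1) * X$3,
       deriv \<gamma>1 (p$1) * X$1 * F (L p) + \<gamma>1 (p$1) * frechet_derivative F (at (L p)) (L X) + deriv \<gamma>2 (p$1) * X$1,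
       deriv \<gamma>1 (p$1) * X$1]" (is "_ = ?P X") if "p \<in> U" for p X
  proof -
    have "(\<phi> has_derivative ?P) (at p)"
      unfolding \<phi>F
      by (rule has_derivative_vec_componentwise, rule forall_4[THEN iffD2, rule_format])
        (auto intro!: derivative_eq_intros derivs that simp: algebra_simps)
    then show ?thesis
      by (simp only: frechet_derivative_at[symmetric])
  qed
  have hess: "hessian \<phi> p X Y = vector
      [deriv (deriv \<gamma>1) (p$1) * X$1 * Y$1 * p$2 + deriv \<gamma>1 (p$1) * (X$1 * Y$2 + Y$1 * X$2),
       deriv (deriv \<gamma>1) (p$1) * X$1 * Y$1 * p$3 + deriv \<gamma>1 (p$1) * (X$1 * Y$3 + Y$1 * X$3),
       deriv (deriv \<gamma>1) (p$1) * X$1 * Y$1 * F (L p)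
         + deriv \<gamma>1 (p$1) * (X$1 * frechet_derivative F (at (L p)) (L Y)
             + Y$1 * frechet_derivative F (at (L p)) (L X))
         + \<gamma>1 (p$1) * hessian F (L p) (L X) (L Y) + deriv (deriv \<gamma>2) (p$1) * X$1 * Y$1,
       deriv (deriv \<gamma>1) (p$1) * X$1 * Y$1]" (is "_ = ?P X") if "p \<in> U" for p X Y
  proof (rule hessian_eqI[OF U_open that push])
    show "((\<lambda>p. vector
      [deriv \<gamma>1 (p$1) * Y$1 * p$2 + \<gamma>1 (p$1) * Y$2,
       deriv \<gamma>1 (p$1) * Y$1 * p$3 + \<gamma>1 (p$1) * Y$3,
       deriv \<gamma>1 (p$1) * Y$1 * F (L p) + \<gamma>1 (p$1) * frechet_derivative F (at (L p)) (L Y) + deriv \<gamma>2 (p$1) * Y$1,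
       deriv \<gamma>1 (p$1) * Y$1] :: real^4) has_derivative ?P) (at p)"
      by (rule has_derivative_vec_componentwise, rule forall_4[THEN iffD2, rule_format])
        (auto intro!: derivative_eq_intros derivs that simp: algebra_simps)
  qed

  define D where "D t = \<gamma>1 t * deriv \<gamma>2 t - deriv \<gamma>1 t * \<gamma>2 t" for t
  define E where "E t = deriv \<gamma>1 t * deriv (deriv \<gamma>2) t - deriv (deriv \<gamma>1) t * deriv \<gamma>2 t" for t
  have signs: "\<gamma>1 t \<noteq> 0" "D t \<noteq> 0" "deriv \<gamma>1 t \<noteq> 0" "\<gamma>1 t * deriv \<gamma>1 t * E t < 0"
    "(\<gamma>1 t)\<^sup>2 * \<bar>D t\<bar> ^ 5 = \<bar>E t\<bar> * (deriv \<gamma>1 t)\<^sup>2" if "t \<in> I" for t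
    unfolding D_def E_def by (rule curve_condition_signs[OF \<gamma>_eq[OF that] \<gamma>_nz[OF that]])+
  define h where "h p X Y = - (E (p$1) * X$1 * Y$1
      + \<gamma>1 (p$1) * deriv \<gamma>1 (p$1) * hessian F (L p) (L X) (L Y)) / D (p$1)" for p X Y :: "real^3"
  have L_axis: "L (axis 1 1) = 0" "L (axis 2 1) = axis 1 1" "L (axis 3 1) = axis 2 1"
    by (simp_all add: L_def vec_eq_iff forall_2 axis_def)
  have L_eq_0: "L X = 0 \<longleftrightarrow> X$2 = 0 \<and> X$3 = 0" for X
    by (simp add: L_def vec_eq_iff forall_2)

  \<comment> \<open>Immersion and transversality\<close>
  have inj: "Z = 0" if "p \<in> U" "push \<phi> p Z = 0" for p Z
  proof -
    \<comment> \<open>The fourth coordinate gives \<open>Z$1 = 0\<close> because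
      \<open>deriv \<gamma>1\<close> is nonzero; the first two then give the rest because
      \<open>\<gamma>1\<close> is nonzero.\<close>
    have "Z$1 = 0" "Z$2 = 0" "Z$3 = 0"
      using that(2) signs(1,3)[of "p$1"] that(1)
      by (auto simp: push[OF that(1)] vec_eq_iff forall_4 U_iff)
    then show ?thesis by (simp add: vec_eq_iff forall_3)
  qed
  have immersed: "immersed_hypersurface U \<phi>"
    unfolding immersed_hypersurface_def
    using U_open \<phi>_smooth inj linear_injective_0[OF linear_frechet_derivative_smooth[OF \<phi>_smooth]]
    by auto

  have transverse: "transverse_field U \<phi> \<phi>"
    unfolding transverse_field_def
  proof (intro conjI ballI \<phi>_smooth notI)
    fix p assume p: "p \<in> U" and "\<phi> p \<in> range (push \<phi> p)"
    then obtain Z where Z: "\<phi> p = push \<phi> p Z" by blast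
    have t: "p$1 \<in> I" "L p \<in> N" using p by (auto simp: U_iff)
    \<comment> \<open>This relation cancels the position terms in the other coordinates, which
      leaves \<open>L Z = 0\<close> and the same relation for \<open>\<gamma>2\<close>. The curve
      would then be parallel to its velocity, that is, \<open>D = 0\<close>.\<close>
    have 4: "\<gamma>1 (p$1) = deriv \<gamma>1 (p$1) * Z$1"
      using Z by (simp add: push[OF p] \<phi>F[of p] vec_eq_iff forall_4)
    have "\<gamma>1 (p$1) * Z$2 = 0" "\<gamma>1 (p$1) * Z$3 = 0"
      using Z by (simp_all add: push[OF p] \<phi>F[of p] vec_eq_iff forall_4 flip: 4)
    then have "L Z = 0"
      using signs(1)[OF t(1)] by (simp add: L_eq_0)
    then have "frechet_derivative F (at (L p)) (L Z) = 0"
      by (simp add: linear_0[OF F'_lin[OF t(2)]])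
    then have "\<gamma>2 (p$1) = deriv \<gamma>2 (p$1) * Z$1"
      using Z by (simp add: push[OF p] \<phi>F[of p] vec_eq_iff forall_4 flip: 4)
    then have "D (p$1) = 0"
      by (simp add: D_def) (simp add: 4)
    then show False
      using signs(2)[OF t(1)] by blast
  qed

  \<comment> \<open>Gauss and Weingarten formulas\<close>
  have gauss: "gauss_formula U \<phi> \<phi> h"
    unfolding gauss_formula_iff_hessian[OF U_open \<phi>_smooth]
  proof (intro ballI allI)
    fix p X Y assume p: "p \<in> U"
    then have t: "p$1 \<in> I" "L p \<in> N" by (auto simp: U_iff)
    let ?t = "p$1"
    define H where "H = hessian F (L p) (L X) (L Y)"
    \<comment> \<open>the coefficients of $\varphi_t$ in $\varphi_{tt}$ and $\varphi_{ij}$, and of $\varphi_i$ in $\varphi_{ti}$\<close>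
    define z where "z = ((\<gamma>1 ?t * deriv (deriv \<gamma>2) ?t - deriv (deriv \<gamma>1) ?t * \<gamma>2 ?t) * X$1 * Y$1
        + (\<gamma>1 ?t)\<^sup>2 * H) / D ?t"
    define r where "r = deriv \<gamma>1 ?t / \<gamma>1 ?t"
    define Z :: "real^3" where "Z = vector [z, r * (X$1 * Y$2 + Y$1 * X$2), r * (X$1 * Y$3 + Y$1 * X$3)]"
    have Z_nth: "Z$1 = z" "Z$2 = r * (X$1 * Y$2 + Y$1 * X$2)" "Z$3 = r * (X$1 * Y$3 + Y$1 * X$3)"
      by (simp_all add: Z_def)
    have "L Z = r *\<^sub>R (X$1 *\<^sub>R L Y + Y$1 *\<^sub>R L X)"
      by (simp add: L_def vec_eq_iff forall_2 Z_nth)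
    then have F'Z: "frechet_derivative F (at (L p)) (L Z)
        = r * (X$1 * frechet_derivative F (at (L p)) (L Y) + Y$1 * frechet_derivative F (at (L p)) (L X))"
      by (simp add: linear_add[OF F'_lin[OF t(2)]] linear_cmul[OF F'_lin[OF t(2)]])
    have r: "\<gamma>1 ?t * (r * s) = deriv \<gamma>1 ?t * s" for s
      using signs(1)[OF t(1)] by (simp add: r_def)
    \<comment> \<open>Facts 1 and 2 form a linear system of determinant \<open>- D ?t\<close> for
      \<open>z\<close> and \<open>h p X Y\<close>; the definitions of both are its solution by
      Cramer's rule.\<close>
    have 1: "deriv (deriv \<gamma>1) ?t * X$1 * Y$1 = deriv \<gamma>1 ?t * z + h p X Y * \<gamma>1 ?t"
      using signs(2)[OF t(1)] unfolding z_def h_def H_def[symmetric]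
      by (simp add: field_simps power2_eq_square) (simp add: D_def E_def algebra_simps)
    have 2: "\<gamma>1 ?t * H + deriv (deriv \<gamma>2) ?t * X$1 * Y$1 = deriv \<gamma>2 ?t * z + h p X Y * \<gamma>2 ?t"
      using signs(2)[OF t(1)] unfolding z_def h_def H_def[symmetric]
      by (simp add: field_simps power2_eq_square) (simp add: D_def E_def algebra_simps)
    \<comment> \<open>Coordinates 1, 2 and 4 are fact 1 times \<open>p$2\<close>, \<open>p$3\<close>
      and 1; the third is fact 1 times \<open>F (L p)\<close> plus fact 2. The mixed terms match by
      the choice of \<open>r\<close>.\<close>
    have "hessian \<phi> p X Y = push \<phi> p Z + h p X Y *\<^sub>R \<phi> p"
      unfolding vec_eq_iff forall_4 hess[OF p] push[OF p] \<phi>F[of p] H_def[symmetric]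
      using 1 2 by (simp add: Z_nth F'Z r) (simp add: algebra_simps)
    then show "\<exists>Z. hessian \<phi> p X Y = push \<phi> p Z + h p X Y *\<^sub>R \<phi> p"
      by blast
  qed

  have weingarten: "weingarten_formula U \<phi> \<phi> (\<lambda>_ X. - X)"
    unfolding weingarten_formula_def
    using linear_neg[OF linear_frechet_derivative_smooth[OF \<phi>_smooth]] by simp

  \<comment> \<open>Nondegeneracy and bilinearity of the metric\<close>
  have nondegenerate: "nondegenerate_on U h"
    unfolding nondegenerate_on_def
  proof (intro ballI allI impI)
    fix p X assume p: "p \<in> U" and *: "\<forall>Y. h p X Y = 0"
    then have t: "p$1 \<in> I" "L p \<in> N" by (auto simp: U_iff)
    \<comment> \<open>The first axis is \<open>h\<close>-orthogonal to the other two, so pairing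
      with it isolates \<open>X$1\<close>. Pairing \<open>X\<close> with itself then leaves the
      positive definite Hessian.\<close>
    have "E (p$1) * X$1 = 0"
      using *[rule_format, of "axis 1 1"] signs(2)[OF t(1)]
      by (simp add: h_def L_axis bilinear_rzero[OF H_bilin[OF t(2)]])
    then have 1: "X$1 = 0"
      using signs(4)[OF t(1)] by auto
    then have "hessian F (L p) (L X) (L X) = 0"
      using *[rule_format, of X] signs(1-3)[OF t(1)] by (simp add: h_def)
    then have "L X = 0"
      using F_pos[OF t(2), of "L X"] by fastforce
    then show "X = 0"
      using 1 unfolding L_eq_0 by (simp add: vec_eq_iff forall_3)
  qed

  have h_bilin: "bilinear (h p)" if "p \<in> U" for p
  proof -
    have "L p \<in> N" using that by (simp add: U_iff)
    note b = H_bilin[OF this]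
    show ?thesis
      unfolding bilinear_def
      by (auto intro!: linearI simp: h_def linear_add[OF L_lin] linear_cmul[OF L_lin]
          bilinear_ladd[OF b] bilinear_radd[OF b] bilinear_lmul[OF b] bilinear_rmul[OF b]
          add_divide_distrib diff_divide_distrib algebra_simps)
  qed

  \<comment> \<open>Volume condition\<close>
  have volume: "volume_condition U \<phi> \<phi> h"
    unfolding volume_condition_def
  proof (intro ballI allI impI)
    fix p and e :: "4 \<Rightarrow> 3 option" and X :: "3 \<Rightarrow> real^3"
    assume p: "p \<in> U" and e: "bij e"
    then have t: "p$1 \<in> I" "L p \<in> N" by (auto simp: U_iff)
    let ?t = "p$1"
    have frame: "det (vector [push \<phi> p (axis 1 1), push \<phi> p (axis 2 1), push \<phi> p (axis 3 1), \<phi> p] :: real^4^4)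
        = (\<gamma>1 ?t)\<^sup>2 * D ?t"
      by (simp add: push[OF p] \<phi>F[of p] L_axis linear_0[OF F'_lin[OF t(2)]] det_4 D_def)
        (simp add: axis_def power2_eq_square algebra_simps)
    define G :: "real^3^3" where "G = (\<chi> i j. h p (axis i 1) (axis j 1))"
    define K :: "real^2^2" where "K = (\<chi> i j. hessian F (L p) (axis i 1) (axis j 1))"
    \<comment> \<open>\<open>G\<close> is block diagonal: the entry \<open>- E / D\<close> and a
      multiple of the 2 by 2 Hessian \<open>K\<close>.\<close>
    have "det G = - E ?t * (\<gamma>1 ?t * deriv \<gamma>1 ?t)\<^sup>2 * det K / D ?t ^ 3"
      by (simp add: G_def K_def h_def det_3 det_2 L_axis bilinear_lzero[OF H_bilin[OF t(2)]]
          bilinear_rzero[OF H_bilin[OF t(2)]])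
        (simp add: axis_def power2_eq_square power3_eq_cube diff_divide_distrib algebra_simps)
    then have "\<bar>det G\<bar> = (\<gamma>1 ?t)\<^sup>2 * (\<bar>E ?t\<bar> * (deriv \<gamma>1 ?t)\<^sup>2) / \<bar>D ?t\<bar> ^ 3"
      using F_det[OF t(2)] by (simp add: abs_mult power_mult_distrib power_abs flip: K_def)
    \<comment> \<open>The curve equation turns the bracket into \<open>\<gamma>1\<close> squared
      times the fifth power of \<open>|D|\<close>; dividing by the cube leaves a perfect
      square.\<close>
    also have "\<dots> = ((\<gamma>1 ?t)\<^sup>2 * \<bar>D ?t\<bar>)\<^sup>2"
      unfolding signs(5)[OF t(1), symmetric]
      using signs(2)[OF t(1)] power_add[of "\<bar>D ?t\<bar>" 2 3]
      by (simp add: field_simps power_mult_distrib)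
    finally have "sqrt \<bar>det G\<bar> = (\<gamma>1 ?t)\<^sup>2 * \<bar>D ?t\<bar>"
      by simp
    then have "sqrt \<bar>det (\<chi> k l. h p (X k) (X l))\<bar> = \<bar>det (\<chi> k. X k)\<bar> * ((\<gamma>1 ?t)\<^sup>2 * \<bar>D ?t\<bar>)"
      by (simp add: det_gram[OF h_bilin[OF p]] abs_mult real_sqrt_mult flip: G_def)
    then show "\<bar>det (\<chi> i. case e i of None \<Rightarrow> \<phi> p | Some k \<Rightarrow> push \<phi> p (X k))\<bar>
        = sqrt \<bar>det (\<chi> k l. h p (X k) (X l))\<bar>"
      by (simp add: abs_det_bordered[OF linear_frechet_derivative_smooth[OF \<phi>_smooth p] e] frame abs_mult)
  qed

  \<comment> \<open>Indefiniteness of the metric\<close>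
  have indefinite: "indefinite_on U h"
    unfolding indefinite_on_def
  proof
    fix p assume "p \<in> U"
    then have t: "p$1 \<in> I" "L p \<in> N" by (auto simp: U_iff)
    define s where "s = hessian F (L p) (axis 1 1) (axis 1 1)"
    have "s > 0"
      unfolding s_def by (rule F_pos[OF t(2)]) (simp add: axis_eq_0_iff)
    have h1: "h p (axis 1 1) (axis 1 1) = - E (p$1) / D (p$1)"
      by (simp add: h_def L_axis bilinear_lzero[OF H_bilin[OF t(2)]])
    have h2: "h p (axis 2 1) (axis 2 1) = - (\<gamma>1 (p$1) * deriv \<gamma>1 (p$1) * s) / D (p$1)"
      by (simp add: h_def L_axis s_def) (simp add: axis_def)
    \<comment> \<open>The sign of \<open>D\<close> is unknown, so which axis is positive is
      undecided. The product involves only its square and is negative.\<close>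
    have "h p (axis 1 1) (axis 1 1) * h p (axis 2 1) (axis 2 1)
        = (\<gamma>1 (p$1) * deriv \<gamma>1 (p$1) * E (p$1)) * s / (D (p$1))\<^sup>2"
      by (simp add: h1 h2 power2_eq_square)
    also have "\<dots> < 0"
      using signs(2,4)[OF t(1)] \<open>s > 0\<close> by (simp add: divide_neg_pos mult_neg_pos)
    finally show "(\<exists>X. h p X X > 0) \<and> (\<exists>Y. h p Y Y < 0)"
      by (auto simp: mult_less_0_iff)
  qed

  have "affine_sphere U \<phi> \<phi> h (- 1)"
    unfolding affine_sphere_def blaschke_structure_def
    using immersed transverse gauss weingarten nondegenerate volume
    by (intro exI[of _ "\<lambda>_ X. - X"]) simp
  then show ?thesis
    unfolding indefinite_proper_affine_sphere_def U_def[symmetric]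
    using indefinite by (intro exI[of _ \<phi>] exI[of _ h] exI[of _ "- 1 :: real"]) simp
qed

end
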